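(* Let $(X,d)$ be a compact metric space and let $f: X \to X$ be a continuous map preserving two distinct Borel probability measures whose ergodic basins of attraction are both dense in $X$. Then the set $$\mathfrak I = \Big\{x \in X : \lim_{n \to +\infty} \frac1n\sum_{j=0}^{n-1} \delta_{f^j(x)} \text{ does not exist in the weak}^* \text{ topology}\Big\}$$ is a Baire residual subset of $X$.
   Context: For an $f$-invariant Borel probability measure $\mu$, the ergodic basin of attraction of $\mu$ is the set of points $x \in X$ such that $\lim_{n \to +\infty} \frac1n\sum_{j=0}^{n-1} \delta_{f^j(x)} = \mu$ in the weak$^*$ topology, where $\delta_y$ is the Dirac measure at $y$. A subset of a topological space is Baire residual if it contains a countable intersection of open dense subsets. *)

theory Defs
  imports "HOL-Probability.Probability"
begin

definition borel_prob_measures :: "'a::topological_space measure set" where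
  "borel_prob_measures = {\<mu>. prob_space \<mu> \<and> sets \<mu> = sets borel}"

(* The coarsest topology on the Borel probability measures that makes integration against every
   continuous real function continuous.  The test functions are not required to be bounded, so
   this is the weak* topology only when the underlying space is compact. *)
definition weak_star_topology :: "'a::topological_space measure topology" where
  "weak_star_topology =
     pullback_topology borel_prob_measures
       (\<lambda>\<mu>. \<lambda>\<phi>\<in>{\<phi> :: 'a \<Rightarrow> real. continuous_on UNIV \<phi>}. integral\<^sup>L \<mu> \<phi>)
       (product_topology (\<lambda>_. euclideanreal) {\<phi>. continuous_on UNIV \<phi>})"

lemma topspace_weak_star_topology [simp]:
  "topspace weak_star_topology = borel_prob_measures"
  by (auto simp: weak_star_topology_def topspace_pullback_topology)

lemma limitin_weak_star_topology:
  "limitin weak_star_topology M \<mu> F \<longleftrightarrow>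
     \<mu> \<in> borel_prob_measures \<and> eventually (\<lambda>i. M i \<in> borel_prob_measures) F \<and>
     (\<forall>\<phi> :: 'a::topological_space \<Rightarrow> real. continuous_on UNIV \<phi> \<longrightarrow>
        ((\<lambda>i. integral\<^sup>L (M i) \<phi>) \<longlongrightarrow> integral\<^sup>L \<mu> \<phi>) F)"
proof -
  let ?C = "{\<phi> :: 'a \<Rightarrow> real. continuous_on UNIV \<phi>}"
  let ?I = "\<lambda>\<mu>. \<lambda>\<phi>\<in>?C. integral\<^sup>L \<mu> \<phi>"
  let ?T = "product_topology (\<lambda>_. euclideanreal) ?C"
  have "limitin weak_star_topology M \<mu> F \<longleftrightarrow>
      \<mu> \<in> borel_prob_measures \<and> eventually (\<lambda>i. M i \<in> borel_prob_measures) F \<and>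
      limitin ?T (\<lambda>i. ?I (M i)) (?I \<mu>) F"
  proof (intro iffI conjI)
    assume L: "limitin weak_star_topology M \<mu> F"
    show "\<mu> \<in> borel_prob_measures"
      using limitin_topspace[OF L] by simp
    show "eventually (\<lambda>i. M i \<in> borel_prob_measures) F"
      using L limitin_def[of weak_star_topology M \<mu> F] openin_topspace[of weak_star_topology]
      by auto
    have "continuous_map weak_star_topology ?T ?I"
      unfolding weak_star_topology_def
      using continuous_map_pullback[of ?T ?T id borel_prob_measures ?I] by simp
    from continuous_map_limit[OF this L]
    show "limitin ?T (\<lambda>i. ?I (M i)) (?I \<mu>) F"
      by (simp add: comp_def)
  next
    assume R: "\<mu> \<in> borel_prob_measures \<and> eventually (\<lambda>i. M i \<in> borel_prob_measures) F \<and>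
      limitin ?T (\<lambda>i. ?I (M i)) (?I \<mu>) F"
    show "limitin weak_star_topology M \<mu> F"
      unfolding limitin_def
    proof (intro conjI allI impI)
      show "\<mu> \<in> topspace weak_star_topology"
        using R by simp
      fix W assume W: "openin weak_star_topology W \<and> \<mu> \<in> W"
      then obtain U where U: "openin ?T U" "W = ?I -` U \<inter> borel_prob_measures"
        unfolding weak_star_topology_def openin_pullback_topology by blast
      have "eventually (\<lambda>i. ?I (M i) \<in> U) F"
        using R W U unfolding limitin_def by blast
      moreover have "eventually (\<lambda>i. M i \<in> borel_prob_measures) F"
        using R by blast
      ultimately show "eventually (\<lambda>i. M i \<in> W) F"
        by eventually_elim (use U in auto)
    qed
  qed
  then show ?thesis
    by (auto simp: limitin_componentwise)
qed

(* For n = 0 this is the zero measure, which is irrelevant for limits as n tends to infinity. *)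
definition empirical_measure ::
    "('a::topological_space \<Rightarrow> 'a) \<Rightarrow> 'a \<Rightarrow> nat \<Rightarrow> 'a measure" where
  "empirical_measure f x n =
     measure_of UNIV (sets borel)
       (\<lambda>A. ennreal (1 / real n) * (\<Sum>j<n. emeasure (return borel ((f ^^ j) x)) A))"

lemma space_empirical_measure [simp]: "space (empirical_measure f x n) = UNIV"
  and sets_empirical_measure [simp, measurable_cong]: "sets (empirical_measure f x n) = sets borel"
  unfolding empirical_measure_def
  by (simp_all add: space_measure_of_conv sets.sigma_sets_eq[of borel, simplified])

lemma emeasure_empirical_measure:
  assumes "A \<in> sets borel"
  shows "emeasure (empirical_measure f x n) A =
    ennreal (1 / real n) * (\<Sum>j<n. emeasure (return borel ((f ^^ j) x)) A)"
proof (rule emeasure_measure_of[OF empirical_measure_def])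
  show "countably_additive (sets (empirical_measure f x n))
     (\<lambda>A. ennreal (1 / real n) * (\<Sum>j<n. emeasure (return borel ((f ^^ j) x)) A))"
  proof (rule countably_additiveI)
    fix B :: "nat \<Rightarrow> 'a set"
    assume "range B \<subseteq> sets (empirical_measure f x n)" "disjoint_family B"
    then have *: "(\<Sum>i. emeasure (return borel y) (B i)) = emeasure (return borel y) (\<Union>i. B i)"
      for y :: 'a
      by (intro suminf_emeasure) auto
    show "(\<Sum>i. ennreal (1 / real n) * (\<Sum>j<n. emeasure (return borel ((f ^^ j) x)) (B i))) =
       ennreal (1 / real n) * (\<Sum>j<n. emeasure (return borel ((f ^^ j) x)) (\<Union>i. B i))"
      by (simp add: * suminf_sum)
  qed
qed (use assms in \<open>auto simp: positive_def\<close>)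

lemma empirical_measure_in_borel_prob_measures:
  assumes "n > 0"
  shows "empirical_measure f x n \<in> borel_prob_measures"
proof -
  have "emeasure (empirical_measure f x n) UNIV = ennreal (1 / real n) * ennreal (real n)"
    by (simp add: emeasure_empirical_measure ennreal_of_nat_eq_real_of_nat)
  also have "\<dots> = 1"
    using assms by (simp flip: ennreal_mult)
  finally show ?thesis
    by (auto simp: borel_prob_measures_def intro: prob_spaceI)
qed

definition preserves :: "('a::topological_space \<Rightarrow> 'a) \<Rightarrow> 'a measure \<Rightarrow> bool" where
  "preserves f \<mu> \<longleftrightarrow> distr \<mu> borel f = \<mu>"

definition ergodic_basin :: "('a::topological_space \<Rightarrow> 'a) \<Rightarrow> 'a measure \<Rightarrow> 'a set" where
  "ergodic_basin f \<mu> = {x. limitin weak_star_topology (empirical_measure f x) \<mu> sequentially}"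

definition irregular_set :: "('a::topological_space \<Rightarrow> 'a) \<Rightarrow> 'a set" where
  "irregular_set f =
     {x. \<nexists>\<nu>. limitin weak_star_topology (empirical_measure f x) \<nu> sequentially}"

definition baire_residual :: "'a::topological_space set \<Rightarrow> bool" where
  "baire_residual S \<longleftrightarrow>
     (\<exists>\<G>. countable \<G> \<and> (\<forall>U\<in>\<G>. open U \<and> closure U = UNIV) \<and> \<Inter>\<G> \<subseteq> S)"

end

theory Submission
  imports Defs
begin

text \<open>
  Two distinct Borel probability measures \<open>\<mu>\<close> and \<open>\<nu>\<close> on a metric space give different integrals to
  some continuous function \<open>\<phi>\<close>.  The integral of \<open>\<phi>\<close> against the empirical measure of \<open>x\<close> is the Birkhoff
  average of \<open>\<phi>\<close> along the orbit of \<open>x\<close>, which for each length depends continuously on \<open>x\<close>.  On one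
  dense set (the basin of \<open>\<mu>\<close>) these averages tend to \<open>integral\<^sup>L \<mu> \<phi>\<close>, on another (the basin of \<open>\<nu>\<close>)
  to the different value \<open>integral\<^sup>L \<nu> \<phi>\<close>.

  Such a sequence of continuous functions must oscillate at a generic point
  (\<open>baire_residual_divergence_set\<close>): coming close to a prescribed value at some time after \<open>N\<close> is an
  open condition, it is dense because it holds on the corresponding basin, and a point that satisfies it
  for both values and all \<open>N\<close> has divergent averages.  Divergence of the averages of the single function
  \<open>\<phi>\<close> already excludes a weak* limit of the empirical measures.
\<close>

section \<open>Generic oscillation\<close>

text \<open>
  The witnesses are the sets of points at which some \<open>g n\<close> with \<open>n \<ge> N\<close> is within a third of the
  distance \<open>dist a b\<close> of \<open>a\<close>, respectively of \<open>b\<close>; a limit would be within a third of both.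
\<close>

lemma baire_residual_divergence_set:
  fixes g :: "nat \<Rightarrow> 'a::topological_space \<Rightarrow> 'b::metric_space"
  assumes cont: "\<And>n. continuous_on UNIV (g n)"
    and "a \<noteq> b"
    and dense_a: "closure {x. (\<lambda>n. g n x) \<longlonglongrightarrow> a} = UNIV"
    and dense_b: "closure {x. (\<lambda>n. g n x) \<longlonglongrightarrow> b} = UNIV"
  shows "baire_residual {x. \<not> convergent (\<lambda>n. g n x)}"
proof -
  define e where "e = dist a b / 3"
  have "e > 0"
    using \<open>a \<noteq> b\<close> by (simp add: e_def)
  define near where "near c N = (\<Union>n\<in>{N..}. {x. dist (g n x) c < e})" for c N
  have open_near: "open (near c N)" for c N
    unfolding near_def by (intro open_UN ballI open_Collect_less continuous_intros cont)
  have dense_near: "closure (near c N) = UNIV"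
    if "closure {x. (\<lambda>n. g n x) \<longlonglongrightarrow> c} = UNIV" for c N
  proof -
    have "x \<in> near c N" if "(\<lambda>n. g n x) \<longlonglongrightarrow> c" for x
    proof -
      have "\<forall>\<^sub>F n in sequentially. dist (g n x) c < e \<and> n \<ge> N"
        using tendstoD[OF that \<open>e > 0\<close>] eventually_ge_at_top[of N] by (rule eventually_conj)
      then show ?thesis
        unfolding near_def eventually_sequentially by auto
    qed
    then have "closure {x. (\<lambda>n. g n x) \<longlonglongrightarrow> c} \<subseteq> closure (near c N)"
      by (intro closure_mono) auto
    with that show ?thesis
      by auto
  qed
  have limit_close: "dist l c \<le> e"
    if lim: "(\<lambda>n. g n x) \<longlonglongrightarrow> l" and near: "\<And>N. x \<in> near c N" for x l c
  proof (rule ccontr)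
    assume "\<not> dist l c \<le> e"
    moreover have "(\<lambda>n. dist (g n x) c) \<longlonglongrightarrow> dist l c"
      by (intro tendsto_intros lim)
    ultimately have "\<forall>\<^sub>F n in sequentially. dist (g n x) c > e"
      by (intro order_tendstoD(1)) auto
    then obtain N where "\<And>n. n \<ge> N \<Longrightarrow> dist (g n x) c > e"
      unfolding eventually_sequentially by blast
    with near[of N] show False
      unfolding near_def by fastforce
  qed
  have "\<not> convergent (\<lambda>n. g n x)" if x: "x \<in> \<Inter>(range (near a) \<union> range (near b))" for x
  proof
    assume "convergent (\<lambda>n. g n x)"
    then obtain l where l: "(\<lambda>n. g n x) \<longlonglongrightarrow> l"
      by (auto simp: convergent_def)
    have "dist l a \<le> e" "dist l b \<le> e"
      using x by (auto intro!: limit_close[OF l])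
    then have "dist a b \<le> 2 * e"
      using dist_triangle3[of a b l] by linarith
    with \<open>e > 0\<close> show False
      by (simp add: e_def)
  qed
  then show ?thesis
    unfolding baire_residual_def
    by (intro exI[of _ "range (near a) \<union> range (near b)"])
       (auto simp: open_near dense_near dense_a dense_b)
qed

section \<open>Continuous functions separate Borel probability measures\<close>

text \<open>
  The indicator of a closed set \<open>C\<close> is the bounded pointwise limit of the continuous functions that
  decrease from 1 to 0 with slope \<open>n\<close> in the distance to \<open>C\<close>, so integrals of continuous functions
  determine the measures of closed sets, and these form a generator of the Borel sets that is
  stable under intersection.
\<close>

lemma borel_prob_measures_eqI:
  fixes \<mu> \<nu> :: "'a::metric_space measure"
  assumes "\<mu> \<in> borel_prob_measures" "\<nu> \<in> borel_prob_measures"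
    and int_eq: "\<And>\<phi> :: 'a \<Rightarrow> real. continuous_on UNIV \<phi> \<Longrightarrow> integral\<^sup>L \<mu> \<phi> = integral\<^sup>L \<nu> \<phi>"
  shows "\<mu> = \<nu>"
proof -
  have meas_closed: "(\<lambda>n. integral\<^sup>L M (\<lambda>x. max 0 (1 - real n * infdist x C))) \<longlonglongrightarrow> measure M C"
    if "M \<in> borel_prob_measures" "closed C" "C \<noteq> {}" for M and C :: "'a set"
  proof -
    interpret prob_space M
      using that by (simp add: borel_prob_measures_def)
    have sets_M [measurable_cong]: "sets M = sets borel"
      using that by (simp add: borel_prob_measures_def)
    have C: "C \<in> sets M"
      using that by (simp add: sets_M)
    have "(\<lambda>n. integral\<^sup>L M (\<lambda>x. max 0 (1 - real n * infdist x C)))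
        \<longlonglongrightarrow> integral\<^sup>L M (indicator C :: 'a \<Rightarrow> real)"
    proof (rule integral_dominated_convergence[where w = "\<lambda>_. 1"])
      show "(\<lambda>x. max 0 (1 - real n * infdist x C)) \<in> borel_measurable M" for n
        unfolding measurable_cong_sets[OF sets_M refl]
        by (intro borel_measurable_continuous_onI continuous_intros)
      show "AE x in M. (\<lambda>n. max 0 (1 - real n * infdist x C)) \<longlonglongrightarrow> indicator C x"
      proof (rule AE_I2)
        fix x
        show "(\<lambda>n. max 0 (1 - real n * infdist x C)) \<longlonglongrightarrow> indicator C x"
        proof (cases "x \<in> C")
          case True
          then show ?thesis
            by simp
        next
          case False
          then have pos: "infdist x C > 0"
            using that by (simp add: infdist_pos_not_in_closed)
          have "\<forall>\<^sub>F n in sequentially. real n \<ge> 1 / infdist x C"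
            using filterlim_real_sequentially by (simp add: filterlim_at_top)
          then have "\<forall>\<^sub>F n in sequentially. max 0 (1 - real n * infdist x C) = 0"
            by eventually_elim (use pos in \<open>simp add: field_simps\<close>)
          with False show ?thesis
            by (simp add: tendsto_eventually)
        qed
      qed
      show "AE x in M. norm (max 0 (1 - real n * infdist x C)) \<le> 1" for n
        by (auto simp: infdist_nonneg)
    qed (use C in auto)
    then show ?thesis
      using C by (simp add: sets.Int_space_eq2)
  qed
  interpret \<mu>: prob_space \<mu>
    using assms by (simp add: borel_prob_measures_def)
  interpret \<nu>: prob_space \<nu>
    using assms by (simp add: borel_prob_measures_def)
  have sets: "sets \<mu> = sigma_sets UNIV (Collect closed)" "sets \<nu> = sigma_sets UNIV (Collect closed)"
    using assms by (simp_all add: borel_prob_measures_def borel_eq_closed)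
  show ?thesis
  proof (rule measure_eqI_generator_eq[OF _ _ _ sets, where A = "\<lambda>_. UNIV"])
    show "emeasure \<mu> C = emeasure \<nu> C" if "C \<in> Collect closed" for C
    proof (cases "C = {}")
      case False
      have "integral\<^sup>L \<mu> (\<lambda>x. max 0 (1 - real n * infdist x C))
          = integral\<^sup>L \<nu> (\<lambda>x. max 0 (1 - real n * infdist x C))" for n
        by (intro int_eq continuous_intros)
      then have "measure \<mu> C = measure \<nu> C"
        using LIMSEQ_unique[OF meas_closed[of \<mu> C]] meas_closed[of \<nu> C] that False assms(1,2)
        by simp
      then show ?thesis
        by (simp add: \<mu>.emeasure_eq_measure \<nu>.emeasure_eq_measure)
    qed simp
  qed (auto simp: Int_stable_def)
qed

section \<open>Empirical measures and Birkhoff averages\<close>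

text \<open>
  An empirical measure is the law of the orbit point at a uniformly chosen time, which turns its
  integrals into finite averages.
\<close>

lemma integral_empirical_measure:
  fixes \<phi> :: "'a::topological_space \<Rightarrow> real"
  assumes [measurable]: "\<phi> \<in> borel_measurable borel" and "n > 0"
  shows "integral\<^sup>L (empirical_measure f x n) \<phi> = (\<Sum>j<n. \<phi> ((f ^^ j) x)) / real n"
proof -
  let ?orbit = "\<lambda>j. (f ^^ j) x"
  let ?time = "uniform_count_measure {..<n}"
  have orbit [measurable]: "?orbit \<in> ?time \<rightarrow>\<^sub>M borel"
    by (simp add: measurable_def space_uniform_count_measure sets_uniform_count_measure)
  have "empirical_measure f x n = distr ?time borel ?orbit"
  proof (rule measure_eqI)
    fix A assume "A \<in> sets (empirical_measure f x n)"
    then have A: "A \<in> sets borel"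
      by simp
    have hits: "(\<Sum>j<n. indicator A (?orbit j) :: ennreal) = of_nat (card {j\<in>{..<n}. ?orbit j \<in> A})"
      by (simp add: indicator_def sum.If_cases Int_def)
    have "emeasure (empirical_measure f x n) A
        = ennreal (1 / real n) * of_nat (card {j\<in>{..<n}. ?orbit j \<in> A})"
      using A by (simp add: emeasure_empirical_measure hits)
    also have "\<dots> = ennreal (real (card {j\<in>{..<n}. ?orbit j \<in> A}) / real n)"
      by (simp add: ennreal_of_nat_eq_real_of_nat flip: ennreal_mult)
    also have "\<dots> = emeasure ?time {j\<in>{..<n}. ?orbit j \<in> A}"
      by (subst emeasure_uniform_count_measure) auto
    also have "\<dots> = emeasure (distr ?time borel ?orbit) A"
      using A by (simp add: emeasure_distr space_uniform_count_measure vimage_def Int_def conj_commute)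
    finally show "emeasure (empirical_measure f x n) A = emeasure (distr ?time borel ?orbit) A" .
  qed simp
  then show ?thesis
    by (simp add: integral_distr integral_uniform_count_measure)
qed

lemma continuous_on_funpow:
  fixes f :: "'a::topological_space \<Rightarrow> 'a"
  assumes "continuous_on UNIV f"
  shows "continuous_on UNIV (f ^^ n)"
proof (induction n)
  case 0
  then show ?case
    by (simp add: id_def)
next
  case (Suc n)
  then show ?case
    using continuous_on_compose2[OF assms Suc.IH] by (simp add: comp_def)
qed

text \<open>
  The integral and the Birkhoff average may disagree at length 0, where the empirical measure is not
  a probability measure; limits do not notice.
\<close>

lemma limitin_weak_star_imp_birkhoff_tendsto:
  fixes \<phi> :: "'a::topological_space \<Rightarrow> real"
  assumes lim: "limitin weak_star_topology (empirical_measure f x) \<mu> sequentially"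
    and cont: "continuous_on UNIV \<phi>"
  shows "(\<lambda>n. (\<Sum>j<n. \<phi> ((f ^^ j) x)) / real n) \<longlonglongrightarrow> integral\<^sup>L \<mu> \<phi>"
proof (rule Lim_transform_eventually)
  show "(\<lambda>n. integral\<^sup>L (empirical_measure f x n) \<phi>) \<longlonglongrightarrow> integral\<^sup>L \<mu> \<phi>"
    using lim cont by (simp add: limitin_weak_star_topology)
  show "\<forall>\<^sub>F n in sequentially.
      integral\<^sup>L (empirical_measure f x n) \<phi> = (\<Sum>j<n. \<phi> ((f ^^ j) x)) / real n"
    using eventually_gt_at_top[of 0]
    by eventually_elim
       (simp add: integral_empirical_measure borel_measurable_continuous_onI[OF cont])
qed

section \<open>Points without a limit of empirical measures\<close>

theorem corollary1:
  fixes f :: "'a::metric_space \<Rightarrow> 'a"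
    and \<mu> \<nu> :: "'a measure"
  assumes "compact (UNIV :: 'a set)"
    and "continuous_on UNIV f"
    and "\<mu> \<in> borel_prob_measures" and "\<nu> \<in> borel_prob_measures"
    and "\<mu> \<noteq> \<nu>"
    and "preserves f \<mu>" and "preserves f \<nu>"
    and "closure (ergodic_basin f \<mu>) = UNIV"
    and "closure (ergodic_basin f \<nu>) = UNIV"
  shows "baire_residual (irregular_set f)"
proof -
  obtain \<phi> :: "'a \<Rightarrow> real"
    where \<phi>: "continuous_on UNIV \<phi>" and separates: "integral\<^sup>L \<mu> \<phi> \<noteq> integral\<^sup>L \<nu> \<phi>"
    using borel_prob_measures_eqI[of \<mu> \<nu>] assms(3-5) by blast
  define birkhoff where "birkhoff n x = (\<Sum>j<n. \<phi> ((f ^^ j) x)) / real n" for n x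
  have tendsto: "(\<lambda>n. birkhoff n x) \<longlonglongrightarrow> integral\<^sup>L \<rho> \<phi>"
    if "limitin weak_star_topology (empirical_measure f x) \<rho> sequentially" for x \<rho>
    unfolding birkhoff_def by (rule limitin_weak_star_imp_birkhoff_tendsto[OF that \<phi>])
  have dense: "closure {x. (\<lambda>n. birkhoff n x) \<longlonglongrightarrow> integral\<^sup>L \<rho> \<phi>} = UNIV"
    if "closure (ergodic_basin f \<rho>) = UNIV" for \<rho>
  proof -
    have "ergodic_basin f \<rho> \<subseteq> {x. (\<lambda>n. birkhoff n x) \<longlonglongrightarrow> integral\<^sup>L \<rho> \<phi>}"
      by (auto simp: ergodic_basin_def tendsto)
    from closure_mono[OF this] that show ?thesis
      by auto
  qed
  have "continuous_on UNIV (\<lambda>x. \<phi> ((f ^^ j) x))" for j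
    using continuous_on_compose2[OF \<phi> continuous_on_funpow[OF assms(2)]] by simp
  then have "continuous_on UNIV (birkhoff n)" for n
    unfolding birkhoff_def divide_inverse by (intro continuous_intros)
  then have "baire_residual {x. \<not> convergent (\<lambda>n. birkhoff n x)}"
    using separates dense[OF assms(8)] dense[OF assms(9)]
    by (rule baire_residual_divergence_set)
  moreover have "{x. \<not> convergent (\<lambda>n. birkhoff n x)} \<subseteq> irregular_set f"
    unfolding irregular_set_def using convergentI[OF tendsto] by blast
  ultimately show ?thesis
    unfolding baire_residual_def by (meson subset_trans)
qed

end
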